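(* Let $t$ be a positive integer with $t\equiv 31\pmod{56}$. Then $18107_2^{(t)}=18107\cdot(2^{15t}-1)/(2^{15}-1)$ is a Riesel number.
   Context: A Riesel number is an odd positive integer $k$ such that $k\cdot 2^n-1$ is composite for all positive integers $n$. For integers $b\ge2$, $k\ge1$, $t\ge1$, the $b$-repinteger is $k_b^{(t)}=k\,(b^{\ell t}-1)/(b^\ell-1)$ with $\ell=\lfloor\log_b k\rfloor+1$; for $k=18107$, $b=2$ one has $\ell=15$. *)

theory Defs
  imports Complex_Main "HOL-Computational_Algebra.Primes"
begin

definition composite :: "nat \<Rightarrow> bool" where
  "composite n \<longleftrightarrow> n > 1 \<and> \<not> prime n"

(* For k > 0 the truncated subtraction is the ordinary one, since then k * 2 ^ n >= 1. *)
definition riesel_number :: "nat \<Rightarrow> bool" where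
  "riesel_number k \<longleftrightarrow> odd k \<and> k > 0 \<and> (\<forall>n>0. composite (k * 2 ^ n - 1))"

definition digit_length :: "nat \<Rightarrow> nat \<Rightarrow> nat" where
  "digit_length b k = nat (\<lfloor>log (real b) (real k)\<rfloor> + 1)"

(* Intended for b >= 2, k >= 1, t >= 1; the division is then exact,
   because b ^ l - 1 divides b ^ (l * t) - 1. *)
definition repinteger :: "nat \<Rightarrow> nat \<Rightarrow> nat \<Rightarrow> nat" where
  "repinteger b k t =
     (let l = digit_length b k in k * (b ^ (l * t) - 1) div (b ^ l - 1))"

end

(* The repinteger is N = 18107 * R, where R is the sum of the first t powers of 2^15.  For
   m = 3 * 5 * 7 * 13 * 17 * 241 the number 2^15 has order 56 modulo (2^15 - 1) * m, so R modulo m is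
   determined by t modulo 56.  With N modulo m known, the covering system  1 (mod 2), 0 (mod 4),
   0 (mod 3), 2 (mod 12), 2 (mod 8), 22 (mod 24)  of the exponents n produces in turn the divisors
   3, 5, 7, 13, 17, 241 of N * 2^n - 1. *)

theory Submission
  imports Defs "HOL-Number_Theory.Cong"
begin

lemma geometric_sum_nat: "y * (\<Sum>i<t. Suc y ^ i) = Suc y ^ t - 1"
proof -
  have "Suc (y * (\<Sum>i<t. Suc y ^ i)) = Suc y ^ t"
    by (induction t) (simp_all add: algebra_simps)
  then show ?thesis by simp
qed

text \<open>With the base written as \<open>Suc y\<close>, the divisor is \<open>y\<close>, and the
  geometric sum exhibits it as a factor of the numerator. The assumption gives \<open>y > 0\<close>,
  so \<open>div\<close> cancels it exactly.\<close>

lemma repinteger_eq_sum: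
  assumes "b ^ digit_length b k > 1"
  shows "repinteger b k t = k * (\<Sum>i<t. (b ^ digit_length b k) ^ i)"
proof -
  obtain y where y: "b ^ digit_length b k = Suc y" "y > 0"
    using assms by (metis Suc_lessE One_nat_def)
  have "repinteger b k t = (k * (Suc y ^ t - 1)) div y"
    by (simp add: repinteger_def Let_def power_mult y)
  also have "\<dots> = (y * (k * (\<Sum>i<t. Suc y ^ i))) div y"
    by (simp only: geometric_sum_nat[symmetric] ac_simps)
  finally show ?thesis using y by simp
qed

text \<open>Congruence modulo \<open>y * m\<close> of multiples of \<open>y\<close> can be divided
  through by \<open>y\<close>, with no coprimality of \<open>y\<close> and \<open>m\<close>.\<close>

lemma geometric_sum_cong:
  fixes y s m t :: nat
  assumes "y > 0" "[Suc y ^ t = Suc (y * s)] (mod y * m)"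
  shows "[(\<Sum>i<t. Suc y ^ i) = s] (mod m)"
proof -
  have "Suc (y * (\<Sum>i<t. Suc y ^ i)) = Suc y ^ t"
    by (simp add: geometric_sum_nat)
  then have "[y * (\<Sum>i<t. Suc y ^ i) = y * s] (mod y * m)"
    using assms(2) by (metis cong_add_rcancel_nat plus_1_eq_Suc add.commute)
  then show ?thesis
    using assms(1) by (simp add: cong_def mod_mult_mult1)
qed

lemma dvd_mult_power2_minus_1:
  fixes N n d r p :: nat
  assumes "[2 ^ d = 1] (mod p)" "[N * 2 ^ r = 1] (mod p)" "n mod d = r"
  shows "p dvd N * 2 ^ n - 1"
proof -
  have "N * 2 ^ n = N * 2 ^ r * (2 ^ d) ^ (n div d)"
    using assms(3) by (metis mult.assoc mod_mult_div_eq power_add power_mult)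
  also have "[\<dots> = 1 * 1 ^ (n div d)] (mod p)"
    by (intro cong_mult cong_pow assms)
  finally show ?thesis
    by (metis cong_to_1_nat mult_1 power_one)
qed

text \<open>All six moduli divide 24, so the 24 residues decide the matter.\<close>

lemma covering_system:
  fixes n :: nat
  shows "n mod 2 = 1 \<or> n mod 4 = 0 \<or> n mod 3 = 0 \<or> n mod 12 = 2 \<or> n mod 8 = 2 \<or> n mod 24 = 22"
proof -
  have "\<forall>j\<in>set [0..<24]. j mod 2 = 1 \<or> j mod 4 = 0 \<or> j mod 3 = 0 \<or> j mod 12 = 2 \<or> j mod 8 = 2
      \<or> j mod 24 = (22 :: nat)"
    by code_simp
  from bspec[OF this, of "n mod 24"] show ?thesis
    by (simp add: mod_mod_cancel)
qed

lemma digit_length_18107: "digit_length 2 18107 = 15"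
proof -
  have "\<lfloor>log 2 (18107 :: real)\<rfloor> = 14"
    using floor_log_nat_eq_powr_iff[of 2 18107 14] by simp
  then show ?thesis by (simp add: digit_length_def)
qed

theorem theorem3p6:
  fixes t :: nat
  assumes "t > 0"
    and "t mod 56 = 31"
  shows "real (repinteger 2 18107 t) = 18107 * (2 ^ (15 * t) - 1) / (2 ^ 15 - 1)
    \<and> riesel_number (repinteger 2 18107 t)"
proof
  define R where "R = (\<Sum>i<t. (32768::nat) ^ i)"
  define N where "N = repinteger 2 18107 t"
  have N: "N = 18107 * R"
    unfolding N_def R_def by (subst repinteger_eq_sum) (simp_all add: digit_length_18107)
  have "Suc (32767 * R) = 2 ^ (15 * t)"
    using geometric_sum_nat[of 32767 t] by (simp add: R_def power_mult)
  then have R: "32767 * real R = 2 ^ (15 * t) - 1"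
    by (metis of_nat_Suc of_nat_mult of_nat_numeral of_nat_power add_diff_cancel_left')
  then show "real (repinteger 2 18107 t) = 18107 * (2 ^ (15 * t) - 1) / (2 ^ 15 - 1)"
    unfolding N_def[symmetric] N by (simp flip: R)

  \<comment> \<open>The factor 32767 in the modulus pays for the division by 32767 = 2^15 - 1, which is not
    invertible modulo the factor 7 of m.\<close>
  define m :: nat where "m = 3 * 5 * 7 * 13 * 17 * 241"
  define c :: nat where "c = 18107 * 3994063"
  have [simp]: "32767 * m = 183246334635" by (simp add: m_def)
  \<comment> \<open>Repeated squaring of reduced residues along 7, 14, 28, 56 keeps the numerals
    small.\<close>
  have x7: "[32768 ^ 7 = 78517366712] (mod 32767 * m)"
    by (simp add: cong_def)
  have x14: "[(32768 ^ 7) ^ 2 = 148461837679] (mod 32767 * m)"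
    by (rule cong_trans[OF cong_pow[OF x7]]) (simp add: cong_def)
  have x28: "[((32768 ^ 7) ^ 2) ^ 2 = 122149314106] (mod 32767 * m)"
    by (rule cong_trans[OF cong_pow[OF x14]]) (simp add: cong_def)
  have x56: "[(((32768 ^ 7) ^ 2) ^ 2) ^ 2 = 1] (mod 32767 * m)"
    by (rule cong_trans[OF cong_pow[OF x28]]) (simp add: cong_def)
  \<comment> \<open>The residue 31 is split as 28 + 3 to reuse \<open>x28\<close>.\<close>
  have "t = 28 + 3 + 56 * (t div 56)"
    using assms(2) mult_div_mod_eq[of 56 t] by linarith
  then have "32768 ^ t = (32768 :: nat) ^ (28 + 3 + 56 * (t div 56))"
    by (rule arg_cong)
  also have "\<dots> = ((32768 ^ 7) ^ 2) ^ 2 * 32768 ^ 3 * ((((32768 ^ 7) ^ 2) ^ 2) ^ 2) ^ (t div 56)"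
    unfolding power_add power_mult[symmetric] by (simp only: arith_simps)
  also have "[\<dots> = 122149314106 * 32768 ^ 3 * 1 ^ (t div 56)] (mod 32767 * m)"
    by (intro cong_mult cong_pow x28 x56 cong_refl)
  \<comment> \<open>The right side has the shape \<open>Suc (y * s)\<close> of
    \<open>geometric_sum_cong\<close>; 3994063 is thus the residue of \<open>R\<close> modulo
    \<open>m\<close>.\<close>
  also have "[122149314106 * 32768 ^ 3 * 1 ^ (t div 56) = Suc (32767 * 3994063)] (mod 32767 * m)"
    by (simp add: cong_def)
  finally have "[R = 3994063] (mod m)"
    using geometric_sum_cong[of 32767 t 3994063 m] by (simp add: R_def)
  then have "[N = c] (mod m)"
    unfolding N c_def by (rule cong_scalar_left)
  then have Nc: "[N = c] (mod p)" if "p dvd m" for p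
    using that cong_dvd_modulus_nat by blast
  have dvd: "p dvd N * 2 ^ n - 1"
    if "p dvd m" "[2 ^ d = 1] (mod p)" "[c * 2 ^ r = 1] (mod p)" "n mod d = r" for p d r n
    using that dvd_mult_power2_minus_1[of d p N r n] Nc[of p]
    by (meson cong_scalar_right cong_trans)

  have odd: "odd N"
  proof -
    obtain s where s: "t = Suc s" using assms(1) gr0_implies_Suc by blast
    \<comment> \<open>Only the term with exponent 0 is odd, and it is present because
      \<open>t > 0\<close>.\<close>
    have "R = 1 + 32768 * (\<Sum>i<s. 32768 ^ i)"
      unfolding R_def s sum.lessThan_Suc_shift by (simp add: sum_distrib_left)
    then show ?thesis by (simp add: N)
  qed
  then have "R > 0" using N by (cases R) auto
  then have large: "N \<ge> 18107" by (simp add: N)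
  have "composite (N * 2 ^ n - 1)" if "n > 0" for n
  proof -
    have "N * 2 \<le> N * 2 ^ n"
      using that by (cases n) auto
    \<comment> \<open>Beyond 241, the largest prime used, each divisor found is proper.\<close>
    then have big: "N * 2 ^ n - 1 > 241" using large by linarith
    have comp: "composite (N * 2 ^ n - 1)"
      if "n mod d = r" "p dvd m" "[2 ^ d = 1] (mod p)" "[c * 2 ^ r = 1] (mod p)" "1 < p" "p \<le> 241"
      for p d r
    proof -
      have "p dvd N * 2 ^ n - 1" by (rule dvd[OF that(2,3,4,1)])
      moreover have "p \<noteq> 1" "p \<noteq> N * 2 ^ n - 1" using that(5,6) big by simp_all
      ultimately show ?thesis
        using big unfolding composite_def prime_nat_iff by auto
    qed
    have "n mod 2 = 1 \<or> n mod 4 = 0 \<or> n mod 3 = 0 \<or> n mod 12 = 2 \<or> n mod 8 = 2 \<or> n mod 24 = 22"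
      by (rule covering_system)
    then show ?thesis
    \<comment> \<open>In each case the modulus \<open>d\<close> is the order of 2 modulo
      \<open>p\<close>, and \<open>r\<close> solves \<open>c * 2 ^ r = 1\<close> modulo
      \<open>p\<close>; only numerals remain to be checked.\<close>
    proof (elim disjE)
      assume "n mod 2 = 1"
      then show ?thesis by (rule comp[where p = 3]) (simp_all add: m_def c_def cong_def)
    next
      assume "n mod 4 = 0"
      then show ?thesis by (rule comp[where p = 5]) (simp_all add: m_def c_def cong_def)
    next
      assume "n mod 3 = 0"
      then show ?thesis by (rule comp[where p = 7]) (simp_all add: m_def c_def cong_def)
    next
      assume "n mod 12 = 2"
      then show ?thesis by (rule comp[where p = 13]) (simp_all add: m_def c_def cong_def)
    next
      assume "n mod 8 = 2"
      then show ?thesis by (rule comp[where p = 17]) (simp_all add: m_def c_def cong_def)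
    next
      assume "n mod 24 = 22"
      then show ?thesis by (rule comp[where p = 241]) (simp_all add: m_def c_def cong_def)
    qed
  qed
  then show "riesel_number (repinteger 2 18107 t)"
    using odd large unfolding riesel_number_def N_def by auto
qed

end
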